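(* Let $d\ge1$ and $X:=[0,1]^d$. A total multifunction $f:X\rightrightarrows\mathbb{R}$ mapping compact sets to compact sets (and in particular one with compact graph) is relatively computable if and only if there exist $\delta_1,\delta_2,\ldots>0$ such that $$\forall x_1\in X\,\exists y_1\in \mathbb{R}\ \forall x_2\in X\,\exists y_2\in \mathbb{R}\cdots\forall x_\ell\in X\,\exists y_\ell\in \mathbb{R}\cdots:\quad y_1\in f(x_1)\ \wedge\ \bigwedge_{\ell\ge1}\Big(x_{\ell+1}\in\overline{B}(x_\ell,\delta_\ell)\rightarrow y_{\ell+1}\in f(x_{\ell+1})\cap\overline{B}(y_\ell,2^{-\ell})\Big),$$ where the infinite quantifier prefix is interpreted as an infinite two-player game.
   Context: A multifunction $f:X\rightrightarrows Y$ is a relation $f\subseteq X\times Y$, with $f(x)=\{y:(x,y)\in f\}$; total means $f(x)\ne\emptyset$ for all $x\in X$; $f[S]=\bigcup_{x\in S}f(x)$. "$f$ maps compact sets to compact sets" means $f[S]$ is compact for every compact $S\subseteq X$. $\overline{B}(z,r)$ denotes the closed ball of radius $r$ around $z$. Game semantics of the formula: there are functions $\eta_\ell:X^\ell\to\mathbb{R}$ ($\ell\ge1$) such that for every sequence $(x_\ell)_{\ell\ge1}$ in $X$ the points $y_\ell:=\eta_\ell(x_1,\dots,x_\ell)$ satisfy the displayed conjunction. Relatively computable means computable relative to some oracle: for some oracle $\mathcal O\subseteq\{0,1\}^*$ there is a Turing machine with oracle $\mathcal O$ which, given any sequence $(q_n)$ in $\mathbb{Q}^d$ with $\|x-q_n\|_\infty\le2^{-n}$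 for all $n\in\mathbb N$ and some $x\in X$, outputs a sequence $(p_m)$ in $\mathbb{Q}$ with $|y-p_m|\le2^{-m}$ for all $m\in\mathbb N$ and some $y\in f(x)$ (where $y$ may depend on the given sequence and not only on $x$). *)

theory Defs
  imports "HOL-Analysis.Analysis" "HOL-Library.Stream"
begin

text \<open>
  Tapes: a one-way read-only input tape holding an infinite binary string, a one-way write-only
  output tape, a two-way infinite work tape with symbols \<open>0, \<dots>, n - 1\<close> (blank \<open>0\<close>), and a two-way
  infinite oracle tape with symbols \<open>0, 1\<close> and blank \<open>None\<close>.  There is no halting state, as only
  infinite outputs matter; a halt amounts to a loop without output.
\<close>

datatype move = MLeft | MStay | MRight

fun offset :: "move \<Rightarrow> int" where
  "offset MLeft = -1"
| "offset MStay = 0"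
| "offset MRight = 1"

record action =
  next_state :: nat
  work_write :: nat
  work_move :: move
  orc_write :: "bool option"
  orc_move :: move
  advance_input :: bool
  emit :: "bool option"

text \<open>
  A state \<open>s\<close> with \<open>query M s = Some (a, b)\<close> is a query state: the machine passes to \<open>a\<close> if the word
  on the oracle tape belongs to the oracle and to \<open>b\<close> otherwise, leaving all tapes unchanged.
  In every other state it acts according to the scanned input, work and oracle tape symbols.
\<close>

record otm =
  num_states :: nat
  num_symbols :: nat
  query :: "nat \<Rightarrow> (nat \<times> nat) option"
  act :: "nat \<Rightarrow> bool \<Rightarrow> nat \<Rightarrow> bool option \<Rightarrow> action"

definition wf_otm :: "otm \<Rightarrow> bool" where
  "wf_otm M \<longleftrightarrow> 0 < num_states M \<and> 0 < num_symbols M \<and>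
     (\<forall>s < num_states M.
        (case query M s of
           Some (a, b) \<Rightarrow> a < num_states M \<and> b < num_states M
         | None \<Rightarrow> (\<forall>i w c. w < num_symbols M \<longrightarrow>
             next_state (act M s i w c) < num_states M \<and>
             work_write (act M s i w c) < num_symbols M)))"

record config =
  state :: nat
  input_rest :: "bool stream"  \<comment> \<open>from the scanned cell onwards\<close>
  work_tape :: "int \<Rightarrow> nat"
  work_head :: int
  orc_tape :: "int \<Rightarrow> bool option"
  orc_head :: int
  written :: "bool list"

definition init_config :: "bool stream \<Rightarrow> config" where
  "init_config u = \<lparr>state = 0, input_rest = u, work_tape = (\<lambda>_. 0), work_head = 0,
     orc_tape = (\<lambda>_. None), orc_head = 0, written = []\<rparr>"

text \<open>The word on the oracle tape starts at cell \<open>0\<close> and extends to the first blank.\<close>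

definition tape_word :: "(int \<Rightarrow> bool option) \<Rightarrow> bool list" where
  "tape_word t = map (\<lambda>k. the (t (int k))) [0..<(LEAST n. t (int n) = None)]"

definition perform :: "action \<Rightarrow> config \<Rightarrow> config" where
  "perform a c = \<lparr>
     state = next_state a,
     input_rest = (if advance_input a then stl (input_rest c) else input_rest c),
     work_tape = (work_tape c)(work_head c := work_write a),
     work_head = work_head c + offset (work_move a),
     orc_tape = (orc_tape c)(orc_head c := orc_write a),
     orc_head = orc_head c + offset (orc_move a),
     written = (case emit a of None \<Rightarrow> written c | Some b \<Rightarrow> written c @ [b])\<rparr>"

definition step :: "otm \<Rightarrow> bool list set \<Rightarrow> config \<Rightarrow> config" where
  "step M \<O> c =
     (case query M (state c) of
        Some (a, b) \<Rightarrow> c\<lparr>state := if tape_word (orc_tape c) \<in> \<O> then a else b\<rparr>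
      | None \<Rightarrow> perform (act M (state c) (shd (input_rest c)) (work_tape c (work_head c))
                            (orc_tape c (orc_head c))) c)"

definition output_at :: "otm \<Rightarrow> bool list set \<Rightarrow> bool stream \<Rightarrow> nat \<Rightarrow> bool list" where
  "output_at M \<O> u t = written ((step M \<O> ^^ t) (init_config u))"

definition computes_output :: "otm \<Rightarrow> bool list set \<Rightarrow> bool stream \<Rightarrow> bool stream \<Rightarrow> bool" where
  "computes_output M \<O> u v \<longleftrightarrow>
     (\<forall>t. output_at M \<O> u t = stake (length (output_at M \<O> u t)) v) \<and>
     (\<forall>n. \<exists>t. n \<le> length (output_at M \<O> u t))"

text \<open>Binary digits, least significant first.\<close>

fun bin_digits :: "nat \<Rightarrow> bool list" where
  "bin_digits 0 = []"
| "bin_digits (Suc n) = odd (Suc n) # bin_digits (Suc n div 2)"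

text \<open>Every digit is preceded by \<open>1\<close>, the end is marked by \<open>0\<close>; hence no code is a proper prefix of
  another one, and sequences can be encoded by plain concatenation.\<close>

definition code_nat :: "nat \<Rightarrow> bool list" where
  "code_nat n = concat (map (\<lambda>b. [True, b]) (bin_digits n)) @ [False]"

definition code_rat :: "rat \<Rightarrow> bool list" where
  "code_rat r = (case quotient_of r of (a, b) \<Rightarrow>
     (a < 0) # code_nat (nat \<bar>a\<bar>) @ code_nat (nat b))"

text \<open>The linear order on the index type only determines in which order the coordinates are written.\<close>

definition code_vec :: "rat ^ ('n::{finite,linorder}) \<Rightarrow> bool list" where
  "code_vec q = concat (map (\<lambda>i. code_rat (q $ i)) (sorted_list_of_set UNIV))"

definition code_seq :: "('a \<Rightarrow> bool list) \<Rightarrow> (nat \<Rightarrow> 'a) \<Rightarrow> bool stream" where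
  "code_seq c s = flat (smap (\<lambda>n. c (s n)) nats)"

definition unit_cube :: "(real ^ 'n) set" where
  "unit_cube = {x. \<forall>i. 0 \<le> x $ i \<and> x $ i \<le> 1}"

definition total_on_cube :: "((real ^ 'n) \<times> real) set \<Rightarrow> bool" where
  "total_on_cube f \<longleftrightarrow> (\<forall>x\<in>unit_cube. f `` {x} \<noteq> {})"

definition maps_compact_to_compact :: "((real ^ 'n) \<times> real) set \<Rightarrow> bool" where
  "maps_compact_to_compact f \<longleftrightarrow> (\<forall>S \<subseteq> unit_cube. compact S \<longrightarrow> compact (f `` S))"

definition real_vec :: "rat ^ 'n \<Rightarrow> real ^ 'n" where
  "real_vec q = (\<chi> i. of_rat (q $ i))"

definition relatively_computable :: "((real ^ ('n::{finite,linorder})) \<times> real) set \<Rightarrow> bool" where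
  "relatively_computable f \<longleftrightarrow>
     (\<exists>(\<O> :: bool list set) M. wf_otm M \<and>
        (\<forall>q :: nat \<Rightarrow> (rat, 'n) vec. \<forall>x\<in>unit_cube.
           (\<forall>n. infnorm (x - real_vec (q n)) \<le> 1 / 2 ^ n) \<longrightarrow>
           (\<exists>p :: nat \<Rightarrow> rat.
              computes_output M \<O> (code_seq code_vec q) (code_seq code_rat p) \<and>
              (\<exists>y \<in> f `` {x}. \<forall>m. \<bar>y - of_rat (p m)\<bar> \<le> 1 / 2 ^ m))))"

definition max_cball :: "real ^ 'n \<Rightarrow> real \<Rightarrow> (real ^ 'n) set" where
  "max_cball z r = {x. infnorm (x - z) \<le> r}"

text \<open>
  Player \<open>\<exists>\<close> wins with a strategy \<open>\<eta>\<close>, whose restriction to lists of length \<open>l\<close> is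
  the function \<open>\<eta>\<^sub>l\<close>.  The moves \<open>x 1, x 2, \<dots>\<close> are numbered from \<open>1\<close>; \<open>x 0\<close> is irrelevant.
\<close>

definition game_formula :: "((real ^ 'n) \<times> real) set \<Rightarrow> (nat \<Rightarrow> real) \<Rightarrow> bool" where
  "game_formula f \<delta> \<longleftrightarrow>
     (\<exists>\<eta> :: (real ^ 'n) list \<Rightarrow> real.
        \<forall>x :: nat \<Rightarrow> real ^ 'n. (\<forall>l\<ge>1. x l \<in> unit_cube) \<longrightarrow>
          (let y = (\<lambda>l. \<eta> (map x [1..<l + 1])) in
             y 1 \<in> f `` {x 1} \<and>
             (\<forall>l\<ge>1. x (l + 1) \<in> max_cball (x l) (\<delta> l) \<longrightarrow>
                y (l + 1) \<in> f `` {x (l + 1)} \<inter> cball (y l) (1 / 2 ^ l))))"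

end

theory Submission
  imports Defs
begin

text \<open>
  Relative to an oracle, computability of a map between sequences is nothing but continuity: a
  machine that copies its input onto the oracle tape can ask for every output bit that the input
  read so far determines (\<open>continuous_map_computable\<close>), and conversely a machine that has made \<open>t\<close>
  steps has seen at most \<open>t\<close> symbols (\<open>output_at_local\<close>).  Since the codes of vectors and rationals
  are self-delimiting, a finite part of a tape and a finite part of the coded sequence determine each
  other, so continuity may be read entrywise.  The theorem thus compares continuous realizers of
  \<open>f\<close> on names with strategies in the game.

  From a strategy to a machine (\<open>computable_if_game_formula\<close>): a name \<open>q\<close> of \<open>x\<close> is thinned out so that
  its entries, clamped to the cube, make up a play whose steps obey the bounds \<open>\<delta>\<close>.  The answers
  \<open>y l\<close> of the strategy form a fast Cauchy sequence, and its limit \<open>y\<close> is the value to be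
  approximated.  The graph of \<open>f\<close> may fail to be closed, so convergence of the moves and of the
  answers does not yet give \<open>y \<in> f(x)\<close>.  But in each round \<open>\<forall>\<close> might have jumped to \<open>x\<close> itself
  instead, within the permitted distance; the answers to these deviations lie in \<open>f(x)\<close> and converge
  to the same \<open>y\<close>, and \<open>f(x) = f[{x}]\<close> is compact.

  From a machine to a strategy (\<open>game_formula_if_computable\<close>): consider only names whose \<open>n\<close>th entry
  lies on a fixed finite grid.  These form a compact space, so one number \<open>N l\<close> of entries suffices
  for all of them to fix approximation \<open>l + 1\<close> in the output (\<open>uniform_output_modulus\<close>).  The
  strategy keeps a name of the current point: when \<open>\<forall>\<close> makes a small step, the first \<open>N l\<close> entries
  are retained and the others replaced by approximations of the new point.  The bounds \<open>\<delta> l\<close> are so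
  small that the retained entries remain admissible as long as the steps are small, and the retained
  entries force consecutive values to be close.
\<close>

section \<open>Prefix codes\<close>

text \<open>
  Stated on infinite streams rather than words, the condition directly allows the first code word
  to be split off the tape, which is how the tape is decoded below.
\<close>

definition self_delimiting :: "('a \<Rightarrow> bool list) \<Rightarrow> bool" where
  "self_delimiting c \<longleftrightarrow>
     (\<forall>a. c a \<noteq> []) \<and> (\<forall>a b s t. c a @- s = c b @- t \<longrightarrow> a = b \<and> s = t)"

lemma self_delimitingD:
  assumes "self_delimiting c" "c a @- s = c b @- t"
  shows "a = b" "s = t"
  using assms unfolding self_delimiting_def by blast+

lemma foldr_bin_digits: "foldr (\<lambda>b n. of_bool b + 2 * n) (bin_digits n) 0 = n"
  by (induction n rule: bin_digits.induct) auto

lemma inj_bin_digits: "inj bin_digits"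
  by (metis foldr_bin_digits injI)

text \<open>
  The two-bit blocks of both streams can be compared from the left; the first block starting with
  \<open>False\<close> ends both words at the same place.
\<close>

lemma marked_digits_shift:
  assumes "concat (map (\<lambda>b. [True, b]) xs) @- False ## s
         = concat (map (\<lambda>b. [True, b]) ys) @- False ## t"
  shows "xs = ys \<and> s = t"
  using assms
proof (induction xs arbitrary: ys)
  case Nil
  then show ?case by (cases ys) auto
next
  case (Cons x xs)
  then show ?case by (cases ys) auto
qed

lemma self_delimiting_code_nat: "self_delimiting code_nat"
proof -
  have "a = b \<and> s = t" if "code_nat a @- s = code_nat b @- t" for a b s t
    using that marked_digits_shift[of "bin_digits a" s "bin_digits b" t] inj_bin_digits
    by (auto simp: code_nat_def dest: injD)
  moreover have "code_nat a \<noteq> []" for a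
    by (simp add: code_nat_def)
  ultimately show ?thesis
    unfolding self_delimiting_def by blast
qed

lemma self_delimiting_code_rat: "self_delimiting code_rat"
proof -
  have "r = r' \<and> s = s'" if eq: "code_rat r @- s = code_rat r' @- s'" for r r' s s'
  proof -
    obtain a b where ab: "quotient_of r = (a, b)" by force
    obtain a' b' where ab': "quotient_of r' = (a', b')" by force
    have pos: "b > 0" "b' > 0"
      using ab ab' quotient_of_denom_pos by blast+
    have sign: "(a < 0) = (a' < 0)"
      and nums: "code_nat (nat \<bar>a\<bar>) @- code_nat (nat b) @- s
               = code_nat (nat \<bar>a'\<bar>) @- code_nat (nat b') @- s'"
      using eq by (auto simp: code_rat_def ab ab')
    have abs: "nat \<bar>a\<bar> = nat \<bar>a'\<bar>"
      and rest: "code_nat (nat b) @- s = code_nat (nat b') @- s'"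
      using self_delimitingD[OF self_delimiting_code_nat nums] by auto
    have "nat b = nat b'" "s = s'"
      using self_delimitingD[OF self_delimiting_code_nat rest] by auto
    moreover have "a = a'"
      using sign abs by (auto simp: abs_if split: if_splits)
    ultimately show ?thesis
      using pos ab ab' by (metis nat_eq_iff2 quotient_of_inject_eq nat_0_le less_imp_le)
  qed
  moreover have "code_rat r \<noteq> []" for r
    by (auto simp: code_rat_def split: prod.split)
  ultimately show ?thesis
    unfolding self_delimiting_def by blast
qed

lemma self_delimiting_code_vec:
  "self_delimiting (code_vec :: rat ^ ('n::{finite,linorder}) \<Rightarrow> bool list)"
proof -
  have words: "(\<forall>i\<in>set is. q $ i = q' $ i) \<and> s = t"
    if "concat (map (\<lambda>i. code_rat (q $ i)) is) @- s = concat (map (\<lambda>i. code_rat (q' $ i)) is) @- t"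
    for q q' :: "(rat, 'n) vec" and "is" s t
    using that
  proof (induction "is")
    case Nil
    then show ?case by simp
  next
    case (Cons i "is")
    then show ?case
      using self_delimitingD[OF self_delimiting_code_rat] by fastforce
  qed
  have "q = q' \<and> s = t" if "code_vec q @- s = code_vec q' @- t" for q q' :: "(rat, 'n) vec" and s t
    using words[of q "sorted_list_of_set UNIV" s q' t] that by (auto simp: code_vec_def vec_eq_iff)
  moreover have "code_vec q \<noteq> []" for q :: "(rat, 'n) vec"
    using self_delimiting_code_rat
    by (auto simp: code_vec_def self_delimiting_def)
  ultimately show ?thesis
    unfolding self_delimiting_def by blast
qed

lemma code_seq_unfold:
  assumes "self_delimiting c"
  shows "code_seq c q = c (q 0) @- code_seq c (\<lambda>i. q (Suc i))"
proof -
  have "smap (\<lambda>n. c (q n)) nats = c (q 0) ## smap (\<lambda>n. c (q n)) (fromN 1)"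
    by (subst siterate.code) simp
  moreover have "smap (\<lambda>n. c (q n)) (fromN 1) = smap (\<lambda>n. c (q (Suc n))) nats"
    by (simp add: smap_alt)
  moreover have "c (q 0) \<noteq> []"
    using assms by (auto simp: self_delimiting_def)
  ultimately show ?thesis
    by (simp add: code_seq_def flat_unfold)
qed

lemma stake_eq_mono:
  assumes "stake n s = stake n t" "m \<le> n"
  shows "stake m s = stake m t"
  using assms by (metis min.absorb1 take_stake)

text \<open>
  Continuity of decoding: the code words of the first \<open>k\<close> entries occupy a finite part of the tape,
  and any tape with the same beginning is split into the same code words.
\<close>

lemma code_seq_decode:
  assumes c: "self_delimiting c"
  shows "\<exists>n. \<forall>q'. stake n (code_seq c q') = stake n (code_seq c q) \<longrightarrow> (\<forall>i<k. q' i = q i)"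
proof (induction k arbitrary: q)
  case 0
  then show ?case by simp
next
  case (Suc k)
  obtain n where n: "\<And>q'. stake n (code_seq c q') = stake n (code_seq c (\<lambda>i. q (Suc i)))
      \<Longrightarrow> \<forall>i<k. q' i = q (Suc i)"
    using Suc by blast
  let ?l = "length (c (q 0))"
  have "\<forall>i<Suc k. q' i = q i"
    if eq: "stake (?l + n) (code_seq c q') = stake (?l + n) (code_seq c q)" for q'
  proof -
    have parts: "stake ?l (code_seq c q') = stake ?l (code_seq c q)"
      "stake n (sdrop ?l (code_seq c q')) = stake n (sdrop ?l (code_seq c q))"
      using arg_cong[OF eq, of "take ?l"] arg_cong[OF eq, of "drop ?l"]
      by (simp_all add: take_stake drop_stake)
    have unf: "code_seq c q = c (q 0) @- code_seq c (\<lambda>i. q (Suc i))"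
      "code_seq c q' = c (q' 0) @- code_seq c (\<lambda>i. q' (Suc i))"
      by (rule code_seq_unfold[OF c])+
    have "stake ?l (code_seq c q) = c (q 0)"
      by (simp add: unf(1) stake_shift)
    then have "c (q 0) @- sdrop ?l (code_seq c q') = code_seq c q'"
      using parts(1) by (metis stake_sdrop)
    then have *: "c (q 0) @- sdrop ?l (code_seq c q') = c (q' 0) @- code_seq c (\<lambda>i. q' (Suc i))"
      using unf(2) by simp
    have "q 0 = q' 0" and dr: "sdrop ?l (code_seq c q') = code_seq c (\<lambda>i. q' (Suc i))"
      using self_delimitingD[OF c *] by auto
    moreover have "sdrop ?l (code_seq c q) = code_seq c (\<lambda>i. q (Suc i))"
      by (simp add: unf(1) sdrop_shift)
    ultimately have "\<forall>i<k. q' (Suc i) = q (Suc i)"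
      using parts(2) n[of "\<lambda>i. q' (Suc i)"] by simp
    then show ?thesis
      using \<open>q 0 = q' 0\<close> by (auto simp: less_Suc_eq_0_disj)
  qed
  then show ?case by blast
qed

text \<open>
  Continuity of encoding: code words are nonempty, so the first \<open>k\<close> bits lie within the first \<open>k\<close>
  words.
\<close>

lemma code_seq_local:
  assumes c: "self_delimiting c" and "\<forall>i<k. p' i = p i"
  shows "stake k (code_seq c p') = stake k (code_seq c p)"
  using assms(2)
proof (induction k arbitrary: p p')
  case 0
  then show ?case by simp
next
  case (Suc k)
  have IH: "stake k (code_seq c (\<lambda>i. p' (Suc i))) = stake k (code_seq c (\<lambda>i. p (Suc i)))"
    using Suc by simp
  have "c (p 0) \<noteq> []"
    using c by (auto simp: self_delimiting_def)
  then have "Suc k - length (c (p 0)) \<le> k"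
    by (cases "c (p 0)") auto
  then have "stake (Suc k - length (c (p 0))) (code_seq c (\<lambda>i. p' (Suc i)))
    = stake (Suc k - length (c (p 0))) (code_seq c (\<lambda>i. p (Suc i)))"
    using IH stake_eq_mono by blast
  then show ?case
    using Suc.prems code_seq_unfold[OF c, of p] code_seq_unfold[OF c, of p']
    by (simp add: stake_shift del: stake.simps)
qed

section \<open>An oracle machine for every continuous map of bit streams\<close>

lemma tape_wordI:
  assumes "\<And>i. i < length w \<Longrightarrow> t (int i) = Some (w ! i)" "t (int (length w)) = None"
  shows "tape_word t = w"
proof -
  have "(LEAST n. t (int n) = None) = length w"
    using assms by (intro Least_equality) (auto intro: leI)
  then show ?thesis
    unfolding tape_word_def using assms(1) by (intro nth_equalityI) auto
qed

text \<open>
  The oracle does all the work.  A round copies one input bit to the oracle tape (state \<open>0\<close>) and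
  appends the tag \<open>True\<close> (state \<open>1\<close>) to ask whether an output bit is due (state \<open>2\<close>).  If so, the tag is
  changed to \<open>False\<close> (state \<open>3\<close>) to ask for that bit (state \<open>4\<close>), which is written in state \<open>5\<close> or \<open>6\<close>.
  The tag is left behind, since the next input bit overwrites it.
\<close>

definition relay_act :: "nat \<Rightarrow> bool \<Rightarrow> nat \<Rightarrow> bool option \<Rightarrow> action" where
  "relay_act s i w c = \<lparr>
     next_state = (if s = 0 then 1 else if s = 1 then 2 else if s = 3 then 4 else 0),
     work_write = 0,
     work_move = MStay,
     orc_write = (if s = 0 then Some i else if s = 1 then Some True
                  else if s = 3 then Some False else c),
     orc_move = (if s = 0 then MRight else MStay),
     advance_input = (s = 0),
     emit = (if s = 5 then Some True else if s = 6 then Some False else None)\<rparr>"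

definition relay :: otm where
  "relay = \<lparr>num_states = 7, num_symbols = 1,
     query = (\<lambda>s. if s = 2 then Some (3, 0) else if s = 4 then Some (5, 6) else None),
     act = relay_act\<rparr>"

lemma wf_relay: "wf_otm relay"
  by (auto simp: wf_otm_def relay_def relay_act_def)

text \<open>
  The word \<open>G w\<close> is meant to be the output written once the input prefix \<open>w\<close> has been processed; it
  grows by at most one bit per input bit.
\<close>

definition relay_oracle :: "(bool list \<Rightarrow> bool list) \<Rightarrow> bool list set" where
  "relay_oracle G = {w @ [True] | w. G w \<noteq> G (butlast w)} \<union> {w @ [False] | w. last (G w)}"

lemma in_relay_oracle:
  "w @ [True] \<in> relay_oracle G \<longleftrightarrow> G w \<noteq> G (butlast w)"
  "w @ [False] \<in> relay_oracle G \<longleftrightarrow> last (G w)"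
  by (auto simp: relay_oracle_def)

text \<open>
  Cell \<open>n\<close> of the oracle tape is left open, because it may still hold the tag of the previous round.
\<close>

definition round_start :: "(bool list \<Rightarrow> bool list) \<Rightarrow> bool stream \<Rightarrow> nat \<Rightarrow> config \<Rightarrow> bool" where
  "round_start G u n c \<longleftrightarrow> state c = 0 \<and> input_rest c = sdrop n u \<and> orc_head c = int n \<and>
     (\<forall>i<n. orc_tape c (int i) = Some (u !! i)) \<and> (\<forall>i>n. orc_tape c (int i) = None) \<and>
     written c = G (stake n u)"

text \<open>
  A round takes three steps if no output bit is due and six steps otherwise.
\<close>

lemma relay_round:
  assumes inc: "\<And>w b. G (w @ [b]) = G w \<or> (\<exists>e. G (w @ [b]) = G w @ [e])"
    and start: "round_start G u n c"
  shows "\<exists>k>0. round_start G u (Suc n) ((step relay (relay_oracle G) ^^ k) c)"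
proof -
  let ?S = "step relay (relay_oracle G)"
  let ?w = "stake (Suc n) u"
  have w: "?w = stake n u @ [u !! n]" by (rule stake_Suc)
  then have butlast: "butlast ?w = stake n u" by (simp del: stake.simps)
  define c1 where "c1 = ?S c"
  have c1: "state c1 = 1" "input_rest c1 = sdrop (Suc n) u" "orc_head c1 = int (Suc n)"
    "written c1 = G (stake n u)"
    and t1: "\<And>i. i \<le> n \<Longrightarrow> orc_tape c1 (int i) = Some (u !! i)"
      "\<And>i. i > n \<Longrightarrow> orc_tape c1 (int i) = None"
    using start by (auto simp: c1_def round_start_def step_def relay_def relay_act_def perform_def)
  have beyond: "orc_tape c1 (2 + int n) = None"
    using t1(2)[of "Suc (Suc n)"] by simp
  define c2 where "c2 = ?S c1"
  have c2: "state c2 = 2" "input_rest c2 = sdrop (Suc n) u" "orc_head c2 = int (Suc n)"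
    "written c2 = G (stake n u)" "orc_tape c2 = (orc_tape c1)(int (Suc n) := Some True)"
    using c1 by (auto simp: c2_def step_def relay_def relay_act_def perform_def)
  have q2: "tape_word (orc_tape c2) = ?w @ [True]"
    by (rule tape_wordI) (auto simp: c2(5) t1 beyond nth_append less_Suc_eq simp del: stake.simps)
  define c3 where "c3 = ?S c2"
  have c3: "input_rest c3 = sdrop (Suc n) u" "orc_head c3 = int (Suc n)"
    "written c3 = G (stake n u)" "orc_tape c3 = orc_tape c2"
    "state c3 = (if G ?w \<noteq> G (stake n u) then 3 else 0)"
    using c2(1-4) by (simp_all add: c3_def step_def relay_def q2 in_relay_oracle[of ?w] butlast
        del: stake.simps)
  show ?thesis
  proof (cases "G ?w = G (stake n u)")
    case True
    have "round_start G u (Suc n) c3"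
      using c3 True by (auto simp: round_start_def c2 t1 simp del: stake.simps)
    moreover have "(?S ^^ 3) c = c3"
      by (simp add: c1_def c2_def c3_def numeral_eq_Suc)
    ultimately show ?thesis
      by (metis zero_less_numeral)
  next
    case False
    then obtain e where e: "G ?w = G (stake n u) @ [e]"
      using inc w by metis
    define c4 where "c4 = ?S c3"
    have c4: "state c4 = 4" "input_rest c4 = sdrop (Suc n) u" "orc_head c4 = int (Suc n)"
      "written c4 = G (stake n u)" "orc_tape c4 = (orc_tape c1)(int (Suc n) := Some False)"
      using c3 c2 False by (auto simp: c4_def step_def relay_def relay_act_def perform_def)
    have q4: "tape_word (orc_tape c4) = ?w @ [False]"
      by (rule tape_wordI) (auto simp: c4(5) t1 beyond nth_append less_Suc_eq simp del: stake.simps)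
    define c5 where "c5 = ?S c4"
    have c5: "input_rest c5 = sdrop (Suc n) u" "orc_head c5 = int (Suc n)"
      "written c5 = G (stake n u)" "orc_tape c5 = orc_tape c4"
      "state c5 = (if e then 5 else 6)"
      using c4(1-4) by (simp_all add: c5_def step_def relay_def q4 in_relay_oracle[of ?w] e
          del: stake.simps)
    have "round_start G u (Suc n) (?S c5)"
      using c5 e by (auto simp: round_start_def c4 t1 step_def relay_def relay_act_def perform_def
          simp del: stake.simps)
    moreover have "(?S ^^ 6) c = ?S c5"
      by (simp add: c1_def c2_def c3_def c4_def c5_def numeral_eq_Suc)
    ultimately show ?thesis
      by (metis zero_less_numeral)
  qed
qed

lemma written_step: "\<exists>zs. written (step M \<O> c) = written c @ zs"
  by (auto simp: step_def perform_def split: option.split)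

lemma output_at_mono: "s \<le> t \<Longrightarrow> \<exists>zs. output_at M \<O> u t = output_at M \<O> u s @ zs"
proof (induction t rule: dec_induct)
  case base
  then show ?case by simp
next
  case (step t)
  then show ?case
    using written_step[of M \<O> "(step M \<O> ^^ t) (init_config u)"] by (auto simp: output_at_def)
qed

text \<open>
  The output between two rounds needs no separate analysis: it is a prefix of the output at the
  start of a later round.
\<close>

lemma relay_computes:
  assumes empty: "G [] = []"
    and inc: "\<And>w b. G (w @ [b]) = G w \<or> (\<exists>e. G (w @ [b]) = G w @ [e])"
    and pre: "\<And>n. G (stake n u) = stake (length (G (stake n u))) v"
    and unbounded: "\<And>k. \<exists>n. k \<le> length (G (stake n u))"
  shows "computes_output relay (relay_oracle G) u v"
proof -
  let ?S = "step relay (relay_oracle G)"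
  have rounds: "\<exists>t\<ge>n. round_start G u n ((?S ^^ t) (init_config u))" for n
  proof (induction n)
    case 0
    have "round_start G u 0 (init_config u)"
      by (simp add: round_start_def init_config_def empty)
    then show ?case
      by (intro exI[of _ 0]) simp
  next
    case (Suc n)
    then obtain t where "t \<ge> n" and t: "round_start G u n ((?S ^^ t) (init_config u))" by blast
    obtain k where "k > 0" "round_start G u (Suc n) ((?S ^^ k) ((?S ^^ t) (init_config u)))"
      using relay_round[OF inc t] by blast
    then show ?case
      using \<open>t \<ge> n\<close> by (intro exI[of _ "k + t"]) (simp add: funpow_add)
  qed
  then have outs: "\<exists>t\<ge>n. output_at relay (relay_oracle G) u t = G (stake n u)" for n
    unfolding output_at_def round_start_def by metis
  have "output_at relay (relay_oracle G) u s
      = stake (length (output_at relay (relay_oracle G) u s)) v" (is "?o s = _") for s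
  proof -
    obtain t where "t \<ge> s" "?o t = G (stake s u)"
      using outs by blast
    moreover obtain zs where "?o t = ?o s @ zs"
      using output_at_mono \<open>t \<ge> s\<close> by blast
    ultimately have "?o s @ zs = stake (length (?o s @ zs)) v"
      using pre[of s] by simp
    then show ?thesis
      by (metis append_eq_conv_conj length_append min.absorb1 le_add1 take_stake)
  qed
  moreover have "\<exists>t. k \<le> length (?o t)" for k
    using unbounded[of k] outs by metis
  ultimately show ?thesis
    unfolding computes_output_def by blast
qed

text \<open>
  The bit \<open>W q !! k\<close> can be written safely after reading \<open>w\<close> if all indices \<open>q\<close> whose input starts
  with \<open>w\<close> agree on it.
\<close>

definition settled :: "('q \<Rightarrow> bool stream) \<Rightarrow> ('q \<Rightarrow> bool stream) \<Rightarrow> bool list \<Rightarrow> nat \<Rightarrow> bool \<Rightarrow> bool" where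
  "settled U W w k b \<longleftrightarrow> (\<forall>q. stake (length w) (U q) = w \<longrightarrow> W q !! k = b)"

lemma settledD: "settled U W (stake n (U q)) k e \<Longrightarrow> W q !! k = e"
  by (simp add: settled_def)

text \<open>
  The greedy output after an input prefix, given in reverse so that the recursion follows the order
  of reading: the next bit is written as soon as it is settled, at most one per input bit.
\<close>

primrec emitted_rev :: "('q \<Rightarrow> bool stream) \<Rightarrow> ('q \<Rightarrow> bool stream) \<Rightarrow> bool list \<Rightarrow> bool list" where
  "emitted_rev U W [] = []"
| "emitted_rev U W (b # r) =
     (let k = length (emitted_rev U W r); w = rev (b # r)
      in emitted_rev U W r @
         (if \<exists>e. settled U W w k e then [SOME e. settled U W w k e] else []))"

text \<open>
  Every continuous map of streams, given by inputs \<open>U q\<close> and outputs \<open>W q\<close>, is computed by the relay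
  machine.  The greedy output is correct as only settled bits are written, and it never gets stuck
  as continuity settles every bit eventually.
\<close>

lemma continuous_map_computable:
  fixes U W :: "'q \<Rightarrow> bool stream"
  assumes cont: "\<And>q k. \<exists>n. \<forall>q'. stake n (U q') = stake n (U q) \<longrightarrow> W q' !! k = W q !! k"
  shows "\<exists>\<O> M. wf_otm M \<and> (\<forall>q. computes_output M \<O> (U q) (W q))"
proof -
  define G where "G w = emitted_rev U W (rev w)" for w
  have snoc: "G (w @ [b]) = G w @
      (if \<exists>e. settled U W (w @ [b]) (length (G w)) e
       then [SOME e. settled U W (w @ [b]) (length (G w)) e] else [])" for w b
    by (simp add: G_def Let_def)
  have snoc_stake: "G (stake (Suc n) u) = G (stake n u) @
      (if \<exists>e. settled U W (stake (Suc n) u) (length (G (stake n u))) e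
       then [SOME e. settled U W (stake (Suc n) u) (length (G (stake n u))) e] else [])" for n u
    unfolding stake_Suc by (rule snoc)
  have "computes_output relay (relay_oracle G) (U q) (W q)" for q
  proof (rule relay_computes)
    show "G [] = []" by (simp add: G_def)
    show "G (w @ [b]) = G w \<or> (\<exists>e. G (w @ [b]) = G w @ [e])" for w b
      by (simp add: snoc)
    show pre: "G (stake n (U q)) = stake (length (G (stake n (U q)))) (W q)" for n
    proof (induction n)
      case 0
      then show ?case by (simp add: G_def)
    next
      case (Suc n)
      let ?k = "length (G (stake n (U q)))"
      let ?P = "settled U W (stake (Suc n) (U q)) ?k"
      show ?case
      proof (cases "\<exists>e. ?P e")
        case True
        then have "?P (SOME e. ?P e)" by (rule someI_ex)
        then have "W q !! ?k = (SOME e. ?P e)"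
          by (rule settledD)
        then have "G (stake (Suc n) (U q)) = G (stake n (U q)) @ [W q !! ?k]"
          using True by (simp add: snoc_stake del: stake.simps)
        also have "\<dots> = stake ?k (W q) @ [W q !! ?k]"
          using Suc by (rule arg_cong[where f = "\<lambda>z. z @ [W q !! ?k]"])
        also have "\<dots> = stake (Suc ?k) (W q)"
          by (rule stake_Suc[symmetric])
        finally have "G (stake (Suc n) (U q)) = stake (Suc ?k) (W q)" .
        then show ?thesis by (simp del: stake.simps)
      next
        case False
        then have "G (stake (Suc n) (U q)) = G (stake n (U q))"
          by (simp add: snoc_stake del: stake.simps)
        then show ?thesis using Suc by (rule ssubst)
      qed
    qed
    have mono: "length (G (stake n (U q))) \<le> length (G (stake (n + d) (U q)))" for n d
      by (induction d) (auto simp: snoc_stake simp del: stake.simps)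
    show "\<exists>n. k \<le> length (G (stake n (U q)))" for k
    proof (induction k)
      case 0
      then show ?case by simp
    next
      case (Suc k)
      then obtain n where n: "k \<le> length (G (stake n (U q)))" by blast
      obtain m where m: "\<forall>q'. stake m (U q') = stake m (U q) \<longrightarrow> W q' !! k = W q !! k"
        using cont by blast
      show ?case
      proof (cases "length (G (stake (n + m) (U q))) = k")
        case True
        have "settled U W (stake (Suc (n + m)) (U q)) k (W q !! k)"
          unfolding settled_def length_stake
          using m stake_eq_mono[of "Suc (n + m)" _ "U q" m] by (metis le_SucI le_add2)
        then have "length (G (stake (Suc (n + m)) (U q))) = Suc k"
          using True by (auto simp: snoc_stake simp del: stake.simps)
        then show ?thesis by (metis order_refl)
      next
        case False
        then show ?thesis
          using mono[of n m] n by (intro exI[of _ "n + m"]) simp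
      qed
    qed
  qed
  then show ?thesis
    using wf_relay by blast
qed

section \<open>Names of points of the cube\<close>

definition is_name :: "(nat \<Rightarrow> rat ^ 'n) \<Rightarrow> real ^ 'n \<Rightarrow> bool" where
  "is_name q x \<longleftrightarrow> (\<forall>n. infnorm (x - real_vec (q n)) \<le> 1 / 2 ^ n)"

lemma infnorm_le_iff: "infnorm x \<le> r \<longleftrightarrow> (\<forall>i. \<bar>x $ i\<bar> \<le> r)" for x :: "real ^ 'n"
proof
  show "\<forall>i. \<bar>x $ i\<bar> \<le> r" if "infnorm x \<le> r"
    using that component_le_infnorm_cart[of x] order_trans by blast
  show "infnorm x \<le> r" if "\<forall>i. \<bar>x $ i\<bar> \<le> r"
    unfolding infnorm_cart by (rule cSup_least) (use that in auto)
qed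

lemma compact_unit_cube: "compact (unit_cube :: (real ^ 'n) set)"
proof -
  have "(unit_cube :: (real ^ 'n) set) = cbox 0 1"
    by (auto simp: unit_cube_def mem_box_cart)
  then show ?thesis by (metis compact_cbox)
qed

text \<open>
  The points compatible with the first \<open>n\<close> entries form a decreasing sequence of nonempty compact
  sets, so some point is compatible with all entries.
\<close>

lemma has_name_if_prefixes_do:
  assumes "\<And>n. \<exists>x\<in>unit_cube. \<forall>i<n. infnorm (x - real_vec (q i)) \<le> 1 / 2 ^ i"
  shows "\<exists>x\<in>unit_cube. is_name q x"
proof -
  define S where "S n = {x \<in> unit_cube. \<forall>i<n. infnorm (x - real_vec (q i)) \<le> 1 / 2 ^ i}" for n
  have "compact (S n)" for n
  proof -
    have "closed (\<Inter>i\<in>{..<n}. {x. infnorm (x - real_vec (q i)) \<le> 1 / 2 ^ i})"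
      by (intro closed_INT ballI closed_Collect_le continuous_intros)
    moreover have "S n = unit_cube \<inter> (\<Inter>i\<in>{..<n}. {x. infnorm (x - real_vec (q i)) \<le> 1 / 2 ^ i})"
      by (auto simp: S_def)
    ultimately show ?thesis
      using compact_Int_closed[OF compact_unit_cube] by simp
  qed
  moreover have "S n \<noteq> {}" for n
    using assms[of n] by (auto simp: S_def)
  moreover have "S n \<subseteq> S m" if "m \<le> n" for m n
    using that by (auto simp: S_def)
  ultimately have "\<Inter> (range S) \<noteq> {}"
    by (rule compact_nest)
  then obtain x where x: "\<And>n. x \<in> S n" by auto
  then have "infnorm (x - real_vec (q n)) \<le> 1 / 2 ^ n" for n
    using x[of "Suc n"] by (auto simp: S_def)
  moreover have "x \<in> unit_cube"
    using x[of 0] by (auto simp: S_def)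
  ultimately show ?thesis by (auto simp: is_name_def)
qed

text \<open>
  Entries of a name may lie outside the cube, but moves in the game may not.
\<close>

definition clamp_to_cube :: "real ^ 'n \<Rightarrow> real ^ 'n" where
  "clamp_to_cube v = (\<chi> i. max 0 (min 1 (v $ i)))"

lemma clamp_to_cube_in: "clamp_to_cube v \<in> unit_cube"
  by (auto simp: clamp_to_cube_def unit_cube_def)

lemma infnorm_clamp_to_cube:
  assumes "x \<in> unit_cube" "infnorm (x - v) \<le> r"
  shows "infnorm (x - clamp_to_cube v) \<le> r"
  unfolding infnorm_le_iff
proof
  fix i
  have "0 \<le> x $ i" "x $ i \<le> 1" "\<bar>x $ i - v $ i\<bar> \<le> r"
    using assms by (auto simp: unit_cube_def infnorm_le_iff)
  then show "\<bar>(x - clamp_to_cube v) $ i\<bar> \<le> r"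
    by (auto simp: clamp_to_cube_def max_def min_def abs_if split: if_splits)
qed

definition dyadic_floor :: "nat \<Rightarrow> real \<Rightarrow> rat" where
  "dyadic_floor n t = of_int \<lfloor>t * 2 ^ n\<rfloor> / 2 ^ n"

lemma dyadic_floor_error: "\<bar>t - of_rat (dyadic_floor n t)\<bar> \<le> 1 / 2 ^ n"
proof -
  have "\<bar>t * 2 ^ n - of_int \<lfloor>t * 2 ^ n\<rfloor>\<bar> \<le> 1" by linarith
  moreover have "t - of_rat (dyadic_floor n t) = (t * 2 ^ n - of_int \<lfloor>t * 2 ^ n\<rfloor>) / 2 ^ n"
    by (simp add: dyadic_floor_def of_rat_divide of_rat_power field_simps)
  ultimately show ?thesis by (simp add: divide_right_mono)
qed

text \<open>
  With precision \<open>2\<^sup>-\<^sup>(\<^sup>n\<^sup>+\<^sup>1\<^sup>)\<close> instead of the permitted \<open>2\<^sup>-\<^sup>n\<close>, an entry remains valid when the point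
  moves a little.
\<close>

definition grid_name :: "real ^ 'n \<Rightarrow> nat \<Rightarrow> rat ^ 'n" where
  "grid_name x n = (\<chi> i. dyadic_floor (Suc n) (x $ i))"

lemma grid_name_error: "infnorm (x - real_vec (grid_name x n)) \<le> 1 / 2 / 2 ^ n"
  unfolding infnorm_le_iff
  using dyadic_floor_error[of _ "Suc n"] by (simp add: real_vec_def grid_name_def)

lemma finite_grid: "finite ((\<lambda>x. grid_name x n) ` (unit_cube :: (real ^ 'n) set))"
proof (rule finite_subset)
  let ?A = "(\<lambda>k. of_int k / 2 ^ Suc n :: rat) ` {0..2 ^ Suc n}"
  show "(\<lambda>x. grid_name x n) ` (unit_cube :: (real ^ 'n) set)
      \<subseteq> vec_lambda ` {g. range g \<subseteq> ?A}"
  proof clarify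
    fix x :: "real ^ 'n" assume x: "x \<in> unit_cube"
    have "dyadic_floor (Suc n) (x $ i) \<in> ?A" for i
    proof -
      have "0 \<le> x $ i" "x $ i \<le> 1"
        using x by (auto simp: unit_cube_def)
      then have "0 \<le> x $ i * 2 ^ Suc n" and le: "x $ i * 2 ^ Suc n \<le> 1 * 2 ^ Suc n"
        by (auto intro: mult_right_mono simp del: power_Suc)
      moreover have "x $ i * 2 ^ Suc n < 2 ^ Suc n + 1"
        using le by linarith
      ultimately have "\<lfloor>x $ i * 2 ^ Suc n\<rfloor> \<in> {0..2 ^ Suc n}"
        by (simp add: floor_le_iff del: power_Suc)
      then show ?thesis unfolding dyadic_floor_def by blast
    qed
    then show "grid_name x n \<in> vec_lambda ` {g. range g \<subseteq> ?A}"
      unfolding grid_name_def by blast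
  qed
  have "finite {g :: 'n \<Rightarrow> rat. range g \<subseteq> ?A}"
    using finite_set_of_finite_funs[of "UNIV :: 'n set" ?A undefined]
    by (auto simp: image_subset_iff)
  then show "finite (vec_lambda ` {g :: 'n \<Rightarrow> rat. range g \<subseteq> ?A})" by simp
qed

section \<open>From a winning strategy to a machine\<close>

text \<open>Indices start at \<open>1\<close>, as do the rounds of the game.\<close>

lemma geometric_steps_converge:
  fixes y :: "nat \<Rightarrow> real"
  assumes step: "\<And>l. l \<ge> 1 \<Longrightarrow> \<bar>y (Suc l) - y l\<bar> \<le> 1 / 2 ^ l"
  shows "\<exists>z. y \<longlonglongrightarrow> z \<and> (\<forall>l\<ge>1. \<bar>z - y l\<bar> \<le> 2 / 2 ^ l)"
proof -
  have tele: "\<bar>y (l + d) - y l\<bar> \<le> 2 / 2 ^ l - 2 / 2 ^ (l + d)" if "l \<ge> 1" for l d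
  proof (induction d)
    case 0
    then show ?case by simp
  next
    case (Suc d)
    have "\<bar>y (l + Suc d) - y l\<bar> \<le> 1 / 2 ^ (l + d) + (2 / 2 ^ l - 2 / 2 ^ (l + d))"
      using step[of "l + d"] Suc that by simp
    then show ?case by simp
  qed
  have near: "\<bar>y m - y l\<bar> \<le> 2 / 2 ^ l" if "1 \<le> l" "l \<le> m" for l m
  proof -
    have "\<bar>y m - y l\<bar> \<le> 2 / 2 ^ l - 2 / 2 ^ m"
      using tele[OF that(1), of "m - l"] that(2) by simp
    moreover have "0 \<le> 2 / (2::real) ^ m" by simp
    ultimately show ?thesis by linarith
  qed
  have "Cauchy y"
  proof (rule CauchyI')
    fix e :: real assume "e > 0"
    then obtain n where n: "(1 / 2) ^ n < e / 2"
      using real_arch_pow_inv[of "e / 2" "1 / 2"] by auto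
    have "dist (y l) (y m) < e" if "Suc n \<le> l" "l < m" for l m
    proof -
      have "2 / 2 ^ l \<le> 2 / (2::real) ^ n"
        using that by (intro divide_left_mono power_increasing) auto
      then show ?thesis
        using near[of l m] that n by (simp add: dist_real_def power_divide abs_minus_commute)
    qed
    then show "\<exists>M. \<forall>l\<ge>M. \<forall>m>l. dist (y l) (y m) < e" by blast
  qed
  then obtain z where z: "y \<longlonglongrightarrow> z"
    using Cauchy_convergent convergent_def by blast
  have "\<bar>z - y l\<bar> \<le> 2 / 2 ^ l" if "l \<ge> 1" for l
  proof (rule LIMSEQ_le_const2)
    show "(\<lambda>m. \<bar>y m - y l\<bar>) \<longlonglongrightarrow> \<bar>z - y l\<bar>"
      by (intro tendsto_intros z)
    show "\<exists>M. \<forall>m\<ge>M. \<bar>y m - y l\<bar> \<le> 2 / 2 ^ l"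
      using near that by blast
  qed
  then show ?thesis using z by blast
qed

text \<open>
  The limit of the answers lies in \<open>f(x)\<close> because it is also approached by the answers to plays that
  jump to \<open>x\<close>, which lie in the closed set \<open>f(x)\<close>.
\<close>

lemma computable_if_game_formula:
  fixes f :: "((real ^ ('n::{finite,linorder})) \<times> real) set"
  assumes vals: "\<And>x. x \<in> unit_cube \<Longrightarrow> closed (f `` {x})"
    and pos: "\<forall>l\<ge>1. \<delta> l > 0"
    and game: "game_formula f \<delta>"
  shows "relatively_computable f"
proof -
  obtain \<eta> where \<eta>: "\<And>x l. (\<forall>l\<ge>1. x l \<in> unit_cube) \<Longrightarrow> 1 \<le> l \<Longrightarrow>
      infnorm (x (Suc l) - x l) \<le> \<delta> l \<Longrightarrow>
      \<eta> (map x [1..<Suc l + 1]) \<in> f `` {x (Suc l)} \<and>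
      \<bar>\<eta> (map x [1..<Suc l + 1]) - \<eta> (map x [1..<l + 1])\<bar> \<le> 1 / 2 ^ l"
    using game unfolding game_formula_def max_cball_def Let_def
    by (auto simp: dist_real_def abs_minus_commute simp del: upt_Suc)
  \<comment> \<open>Both the current and the next move are close to \<open>x\<close>, hence the factor \<open>2\<close>.\<close>
  have "\<exists>k. 1 \<le> l \<longrightarrow> 2 / 2 ^ k \<le> \<delta> l" for l
  proof (cases "1 \<le> l")
    case True
    then obtain k where "(1 / 2) ^ k < \<delta> l / 2"
      using real_arch_pow_inv[of "\<delta> l / 2" "1 / 2"] pos by auto
    then show ?thesis by (intro exI[of _ k]) (simp add: power_divide)
  qed auto
  then obtain k where k: "\<And>l. 1 \<le> l \<Longrightarrow> 2 / 2 ^ k l \<le> \<delta> l"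
    by metis
  \<comment> \<open>Partial sums serve as a monotone sequence above \<open>k\<close>.\<close>
  define n where "n l = (\<Sum>i\<le>l. k i)" for l
  have n_mono: "n l \<le> n m" if "l \<le> m" for l m
    unfolding n_def using that by (intro sum_mono2) auto
  have n: "2 / 2 ^ n l \<le> \<delta> l" if "1 \<le> l" for l
  proof -
    have "k l \<le> n l"
      unfolding n_def by (rule member_le_sum) auto
    then have "2 / 2 ^ n l \<le> 2 / (2::real) ^ k l"
      by (intro divide_left_mono power_increasing) auto
    then show ?thesis using k[OF that] by simp
  qed
  define X :: "(nat \<Rightarrow> (rat, 'n) vec) \<Rightarrow> nat \<Rightarrow> (real, 'n) vec"
    where "X q l = clamp_to_cube (real_vec (q (n l)))" for q l
  define Y where "Y q l = \<eta> (map (X q) [1..<l + 1])" for q l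
  \<comment> \<open>The limit of the answers is within \<open>2 / 2 ^ (m + 2)\<close> of answer \<open>m + 2\<close>, and rounding costs as
    much again.\<close>
  define p where "p q m = dyadic_floor (Suc m) (Y q (m + 2))" for q m
  have "\<exists>N. \<forall>q'. stake N (code_seq code_vec q') = stake N (code_seq code_vec q) \<longrightarrow>
      code_seq code_rat (p q') !! j = code_seq code_rat (p q) !! j" for q j
  proof -
    obtain N where N: "\<forall>q'. stake N (code_seq code_vec q') = stake N (code_seq code_vec q) \<longrightarrow>
        (\<forall>i<Suc (n (j + 2)). q' i = q i)"
      using code_seq_decode[OF self_delimiting_code_vec] by blast
    have "code_seq code_rat (p q') !! j = code_seq code_rat (p q) !! j"
      if "stake N (code_seq code_vec q') = stake N (code_seq code_vec q)" for q'
    proof -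
      have same: "q' i = q i" if "i \<le> n (j + 2)" for i
        using N \<open>stake N _ = _\<close> le_imp_less_Suc[OF that] by blast
      have "p q' m = p q m" if "m < Suc j" for m
      proof -
        have "n l \<le> n (j + 2)" if "l < m + 2 + 1" for l
          using that \<open>m < Suc j\<close> by (intro n_mono) simp
        then have "map (X q') [1..<m + 2 + 1] = map (X q) [1..<m + 2 + 1]"
          using same by (intro map_cong) (auto simp: X_def)
        then show ?thesis by (simp only: p_def Y_def)
      qed
      then have "stake (Suc j) (code_seq code_rat (p q')) = stake (Suc j) (code_seq code_rat (p q))"
        by (intro code_seq_local self_delimiting_code_rat) blast
      then show ?thesis by (metis lessI stake_nth)
    qed
    then show ?thesis by blast
  qed
  then obtain \<O> M where M: "wf_otm M"
    "\<And>q. computes_output M \<O> (code_seq code_vec q) (code_seq code_rat (p q))"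
    using continuous_map_computable[of "code_seq code_vec" "\<lambda>q. code_seq code_rat (p q)"] by blast
  have "\<exists>y \<in> f `` {x}. \<forall>m. \<bar>y - of_rat (p q m)\<bar> \<le> 1 / 2 ^ m"
    if x: "x \<in> unit_cube" and q: "\<forall>n. infnorm (x - real_vec (q n)) \<le> 1 / 2 ^ n" for q x
  proof -
    have X_in: "X q l \<in> unit_cube" for l
      by (simp add: X_def clamp_to_cube_in)
    have X_near: "infnorm (x - X q l) \<le> 1 / 2 ^ n l" for l
      unfolding X_def using x q by (intro infnorm_clamp_to_cube) auto
    have "infnorm (X q (Suc l) - X q l) \<le> \<delta> l" if "1 \<le> l" for l
    proof -
      have "infnorm (X q (Suc l) - X q l) \<le> infnorm (X q (Suc l) - x) + infnorm (x - X q l)"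
        using infnorm_triangle[of "X q (Suc l) - x" "x - X q l"] by simp
      also have "\<dots> \<le> 1 / 2 ^ n (Suc l) + 1 / 2 ^ n l"
        using X_near[of l] X_near[of "Suc l"] by (simp add: infnorm_sub)
      also have "\<dots> \<le> 1 / 2 ^ n l + 1 / 2 ^ n l"
        using n_mono[of l "Suc l"] by (intro add_right_mono divide_left_mono power_increasing) auto
      also have "\<dots> \<le> \<delta> l" using n[OF that] by simp
      finally show ?thesis .
    qed
    then have "\<bar>Y q (Suc l) - Y q l\<bar> \<le> 1 / 2 ^ l" if "1 \<le> l" for l
      unfolding Y_def using \<eta>[of "X q" l] X_in that by blast
    then obtain y where lim: "Y q \<longlonglongrightarrow> y" and y: "\<And>l. 1 \<le> l \<Longrightarrow> \<bar>y - Y q l\<bar> \<le> 2 / 2 ^ l"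
      using geometric_steps_converge by metis
    \<comment> \<open>The answers to the plays that jump to \<open>x\<close> in round \<open>l + 1\<close>.\<close>
    define z where "z l = \<eta> (map ((X q)(Suc l := x)) [1..<Suc l + 1])" for l
    have z: "z l \<in> f `` {x} \<and> \<bar>z l - Y q l\<bar> \<le> 1 / 2 ^ l" if "1 \<le> l" for l
    proof -
      have "1 / 2 ^ n l \<le> 2 / (2::real) ^ n l" by (simp add: divide_right_mono)
      then have "infnorm (x - X q l) \<le> \<delta> l"
        using X_near[of l] n[OF that] by linarith
      moreover have "map ((X q)(Suc l := x)) [1..<l + 1] = map (X q) [1..<l + 1]"
        by (intro map_cong) auto
      ultimately show ?thesis
        using \<eta>[of "(X q)(Suc l := x)" l] X_in x that by (simp add: z_def Y_def del: upt_Suc)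
    qed
    have "(\<lambda>l. z (Suc l)) \<longlonglongrightarrow> y"
    proof -
      have "(\<lambda>l. z (Suc l) - Y q (Suc l)) \<longlonglongrightarrow> 0"
      proof (rule Lim_null_comparison)
        show "\<forall>\<^sub>F l in sequentially. norm (z (Suc l) - Y q (Suc l)) \<le> (1 / 2) ^ Suc l"
          using z by (auto simp: power_divide simp del: power_Suc)
        show "(\<lambda>l. (1 / 2) ^ Suc l) \<longlonglongrightarrow> (0::real)"
          by (intro LIMSEQ_Suc LIMSEQ_realpow_zero) auto
      qed
      then have "(\<lambda>l. (z (Suc l) - Y q (Suc l)) + Y q (Suc l)) \<longlonglongrightarrow> 0 + y"
        by (intro tendsto_add LIMSEQ_Suc[OF lim])
      then show ?thesis by simp
    qed
    moreover have "z (Suc l) \<in> f `` {x}" for l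
      using z by simp
    ultimately have "y \<in> f `` {x}"
      using vals[OF x] closed_sequentially by metis
    moreover have "\<bar>y - of_rat (p q m)\<bar> \<le> 1 / 2 ^ m" for m
      using y[of "m + 2"] dyadic_floor_error[of "Y q (m + 2)" "Suc m"] by (simp add: p_def)
    ultimately show ?thesis by blast
  qed
  then show ?thesis
    unfolding relatively_computable_def using M by blast
qed

section \<open>From a machine to a winning strategy\<close>

text \<open>
  A step advances the input head by at most one cell, so the runs on two inputs that share their
  first \<open>n\<close> bits differ only in the unread input during the first \<open>n\<close> steps.
\<close>

lemma output_at_local:
  assumes "stake n u' = stake n u" "t \<le> n"
  shows "output_at M \<O> u' t = output_at M \<O> u t"
proof -
  let ?c' = "\<lambda>t. (step M \<O> ^^ t) (init_config u')" and ?c = "\<lambda>t. (step M \<O> ^^ t) (init_config u)"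
  have "?c' t = (?c t)\<lparr>input_rest := input_rest (?c' t)\<rparr> \<and>
      stake (n - t) (input_rest (?c' t)) = stake (n - t) (input_rest (?c t))"
    using assms(2)
  proof (induction t)
    case 0
    then show ?case using assms(1) by (simp add: init_config_def)
  next
    case (Suc t)
    define c' c i' where "c' = ?c' t" and "c = ?c t" and "i' = input_rest c'"
    have c': "c' = c\<lparr>input_rest := i'\<rparr>" and i': "stake (n - t) i' = stake (n - t) (input_rest c)"
      using Suc by (simp_all add: c'_def c_def i'_def)
    have nt: "n - t = Suc (n - Suc t)"
      using Suc.prems by simp
    have *: "shd i' = shd (input_rest c)"
      "stake (n - Suc t) (stl i') = stake (n - Suc t) (stl (input_rest c))"
      "stake (n - Suc t) i' = stake (n - Suc t) (input_rest c)"
      using i' stake_eq_mono[OF i', of "n - Suc t"] unfolding nt by auto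
    have "step M \<O> c' = (step M \<O> c)\<lparr>input_rest := input_rest (step M \<O> c')\<rparr> \<and>
      stake (n - Suc t) (input_rest (step M \<O> c')) = stake (n - Suc t) (input_rest (step M \<O> c))"
      unfolding c' using * by (auto simp: step_def perform_def split: option.split)
    then show ?case by (simp add: c'_def c_def)
  qed
  then show ?thesis
    unfolding output_at_def by (metis config.select_convs(7) config.surjective config.update_convs(2))
qed

text \<open>
  The step \<open>t\<close> by which the code of \<open>p m\<close> has been written bounds the bits, and so the entries, that
  have been read.
\<close>

lemma output_modulus:
  assumes c: "self_delimiting c" and e: "self_delimiting e"
    and comp: "computes_output M \<O> (code_seq c q) (code_seq e p)"
  shows "\<exists>t. \<forall>q' p'. (\<forall>i<t. q' i = q i) \<longrightarrow>
      computes_output M \<O> (code_seq c q') (code_seq e p') \<longrightarrow> p' m = p m"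
proof -
  obtain L where L: "\<forall>p'. stake L (code_seq e p') = stake L (code_seq e p) \<longrightarrow>
      (\<forall>i<Suc m. p' i = p i)"
    using code_seq_decode[OF e] by blast
  obtain t where t: "L \<le> length (output_at M \<O> (code_seq c q) t)"
    using comp unfolding computes_output_def by blast
  let ?o = "output_at M \<O> (code_seq c q) t"
  have "p' m = p m" if same: "\<forall>i<t. q' i = q i"
    and comp': "computes_output M \<O> (code_seq c q') (code_seq e p')" for q' p'
  proof -
    have "output_at M \<O> (code_seq c q') t = ?o"
      using code_seq_local[OF c same] by (rule output_at_local) simp
    then have "stake (length ?o) (code_seq e p') = stake (length ?o) (code_seq e p)"
      using comp comp' unfolding computes_output_def by metis
    then have "stake L (code_seq e p') = stake L (code_seq e p)"
      using t by (rule stake_eq_mono)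
    then show ?thesis using L by blast
  qed
  then show ?thesis by blast
qed

text \<open>
  Compactness of a product of finite sets, in the form of Koenig's lemma: the pigeonhole principle
  extends a prefix shared by infinitely many of the sequences by one more entry.
\<close>

lemma finitely_branching_cluster_point:
  fixes G :: "nat \<Rightarrow> 'a set" and s :: "nat \<Rightarrow> nat \<Rightarrow> 'a"
  assumes fin: "\<And>i. finite (G i)" and s: "\<And>k i. s k i \<in> G i"
  shows "\<exists>q. \<forall>n. infinite {k :: nat. \<forall>i<n. s k i = q i}"
proof -
  have "\<exists>r. \<forall>n. infinite {k. \<forall>i<n. s k i = r n i} \<and> (\<forall>i<n. r (Suc n) i = r n i)"
  proof (rule dependent_nat_choice)
    show "\<exists>q. infinite {k. \<forall>i<0. s k i = q i}" by simp
    fix q n assume inf: "infinite {k. \<forall>i<n. s k i = q i}" (is "infinite ?A")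
    have "finite ((\<lambda>k. s k n) ` ?A)"
      by (rule finite_subset[OF _ fin[of n]]) (use s in auto)
    then obtain k0 where "infinite {k \<in> ?A. s k n = s k0 n}"
      using pigeonhole_infinite[OF inf] by blast
    moreover have "{k \<in> ?A. s k n = s k0 n} \<subseteq> {k. \<forall>i<Suc n. s k i = (q(n := s k0 n)) i}"
      by (auto simp: less_Suc_eq)
    ultimately have "infinite {k. \<forall>i<Suc n. s k i = (q(n := s k0 n)) i}"
      using infinite_super by blast
    then show "\<exists>q'. infinite {k. \<forall>i<Suc n. s k i = q' i} \<and> (\<forall>i<n. q' i = q i)"
      by (intro exI[of _ "q(n := s k0 n)"]) auto
  qed
  then obtain r where r: "\<And>n. infinite {k. \<forall>i<n. s k i = r n i}"
    "\<And>n i. i < n \<Longrightarrow> r (Suc n) i = r n i" by blast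
  have diag: "r n i = r (Suc i) i" if "i < n" for n i
    using Suc_leI[OF that] by (induction n rule: dec_induct) (simp_all add: r(2))
  have "{k. \<forall>i<n. s k i = r n i} = {k. \<forall>i<n. s k i = r (Suc i) i}" for n
    by (intro Collect_cong) (metis diag)
  then have "infinite {k. \<forall>i<n. s k i = r (Suc i) i}" for n
    using r(1)[of n] by (rule subst)
  then show ?thesis
    by (intro exI[of _ "\<lambda>i. r (Suc i) i"]) blast
qed

text \<open>
  Suppose that for every \<open>N\<close> some name on the grid and some other sequence agree below \<open>N\<close>, but
  their outputs differ at \<open>m\<close>.  A cluster point of the names is again a name of a point of the cube,
  so the machine has a finite modulus there.  Both members of some pair agree with the cluster point
  up to this modulus, hence their outputs at \<open>m\<close> coincide with the one at the cluster point.
\<close>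

lemma uniform_output_modulus:
  fixes G :: "nat \<Rightarrow> (rat ^ ('n::{finite,linorder})) set"
  assumes fin: "\<And>i. finite (G i)"
    and total: "\<And>(q :: nat \<Rightarrow> (rat, 'n) vec) x. x \<in> unit_cube \<Longrightarrow> is_name q x \<Longrightarrow>
      \<exists>p. computes_output M \<O> (code_seq code_vec q) (code_seq code_rat p)"
  shows "\<exists>N. \<forall>q x q' p p'. x \<in> unit_cube \<longrightarrow> is_name q x \<longrightarrow> (\<forall>i. q i \<in> G i) \<longrightarrow>
      (\<forall>i<N. q' i = q i) \<longrightarrow>
      computes_output M \<O> (code_seq code_vec q) (code_seq code_rat p) \<longrightarrow>
      computes_output M \<O> (code_seq code_vec q') (code_seq code_rat p') \<longrightarrow> p' m = p m"
proof (rule ccontr)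
  assume "\<not> ?thesis"
  then have "\<forall>N. \<exists>q x q' p p'. x \<in> unit_cube \<and> is_name q x \<and> (\<forall>i. q i \<in> G i) \<and>
      (\<forall>i<N. q' i = q i) \<and>
      computes_output M \<O> (code_seq code_vec q) (code_seq code_rat p) \<and>
      computes_output M \<O> (code_seq code_vec q') (code_seq code_rat p') \<and> p' m \<noteq> p m"
    by meson
  then obtain s x s' p p' where
    bad: "\<And>N. x N \<in> unit_cube" "\<And>N. is_name (s N) (x N)" "\<And>N i. s N i \<in> G i"
      "\<And>N i. i < N \<Longrightarrow> s' N i = s N i"
      "\<And>N. computes_output M \<O> (code_seq code_vec (s N)) (code_seq code_rat (p N))"
      "\<And>N. computes_output M \<O> (code_seq code_vec (s' N)) (code_seq code_rat (p' N))"
      "\<And>N. p' N m \<noteq> p N m"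
    by metis
  obtain q where q: "\<And>n. infinite {k. \<forall>i<n. s k i = q i}"
    using finitely_branching_cluster_point[of G s] fin bad(3) by blast
  have "\<exists>x\<in>unit_cube. \<forall>i<n. infnorm (x - real_vec (q i)) \<le> 1 / 2 ^ i" for n
  proof -
    obtain k where k: "\<forall>i<n. s k i = q i"
      using q[of n] not_finite_existsD by blast
    have "\<forall>i<n. infnorm (x k - real_vec (q i)) \<le> 1 / 2 ^ i"
      using bad(2)[of k] k unfolding is_name_def by metis
    then show ?thesis using bad(1) by blast
  qed
  then obtain z where "z \<in> unit_cube" "is_name q z"
    using has_name_if_prefixes_do by blast
  then obtain r where "computes_output M \<O> (code_seq code_vec q) (code_seq code_rat r)"
    using total by blast
  then obtain t where t: "\<And>q' p'. \<forall>i<t. q' i = q i \<Longrightarrow>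
      computes_output M \<O> (code_seq code_vec q') (code_seq code_rat p') \<Longrightarrow> p' m = r m"
    using output_modulus[OF self_delimiting_code_vec self_delimiting_code_rat] by blast
  obtain k where k: "k \<ge> t" "\<forall>i<t. s k i = q i"
    using q[of t] unfolding infinite_nat_iff_unbounded_le by blast
  then have "\<forall>i<t. s' k i = q i"
    using bad(4) by simp
  then have "p' k m = r m" "p k m = r m"
    using t bad(5,6) k by blast+
  then show False using bad(7) by metis
qed

text \<open>
  The name kept by the strategy, for the list of moves in reverse order.  After a step that violates
  the bound \<open>\<delta>\<close> the strategy starts afresh.
\<close>

primrec glued_name ::
  "(nat \<Rightarrow> real) \<Rightarrow> (nat \<Rightarrow> nat) \<Rightarrow> (real ^ 'n) list \<Rightarrow> nat \<Rightarrow> rat ^ 'n" where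
  "glued_name \<delta> N [] = grid_name 0"
| "glued_name \<delta> N (x # r) = (\<lambda>n.
     if r \<noteq> [] \<and> infnorm (x - hd r) \<le> \<delta> (length r) \<and> n < N (length r)
     then glued_name \<delta> N r n else grid_name x n)"

lemma glued_name_in_grid:
  "r \<noteq> [] \<Longrightarrow> set r \<subseteq> unit_cube \<Longrightarrow> glued_name \<delta> N r n \<in> (\<lambda>x. grid_name x n) ` unit_cube"
  by (induction r) auto

text \<open>
  A fresh entry of a name uses half of the admissible error.  The error budget
  \<open>(1 - 2\<^sup>-\<^sup>l) / 2\<^sup>n\<close> grows by \<open>2\<^sup>-\<^sup>(\<^sup>l\<^sup>+\<^sup>1\<^sup>) / 2\<^sup>n\<close> from round \<open>l\<close> to the next, which is at least \<open>\<delta> l\<close>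
  for the retained entries \<open>n < N l\<close>.
\<close>

lemma glued_name_error:
  assumes \<delta>: "\<And>l. \<delta> l = 1 / 2 ^ (N l + l + 1)" and "r \<noteq> []"
  shows "infnorm (hd r - real_vec (glued_name \<delta> N r n)) \<le> (1 - 1 / 2 ^ length r) / 2 ^ n"
  using assms(2)
proof (induction r)
  case Nil
  then show ?case by simp
next
  case (Cons x r)
  show ?case
  proof (cases "r \<noteq> [] \<and> infnorm (x - hd r) \<le> \<delta> (length r) \<and> n < N (length r)")
    case True
    let ?l = "length r" and ?v = "real_vec (glued_name \<delta> N r n)"
    have "\<delta> ?l \<le> 1 / 2 ^ (n + ?l + 1)"
      unfolding \<delta> using True by (intro divide_left_mono power_increasing) auto
    moreover have "infnorm (x - ?v) \<le> infnorm (x - hd r) + infnorm (hd r - ?v)"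
      using infnorm_triangle[of "x - hd r" "hd r - ?v"] by simp
    ultimately have "infnorm (x - ?v) \<le> 1 / 2 ^ (n + ?l + 1) + (1 - 1 / 2 ^ ?l) / 2 ^ n"
      using Cons.IH True by linarith
    also have "\<dots> = (1 - 1 / 2 ^ Suc ?l) / 2 ^ n"
      by (simp add: field_simps power_add)
    finally show ?thesis using True by simp
  next
    case False
    have "(1::real) / 2 / 2 ^ n \<le> (1 - 1 / 2 ^ Suc (length r)) / 2 ^ n"
      by (intro divide_right_mono) (auto simp: field_simps)
    then have "infnorm (x - real_vec (grid_name x n)) \<le> (1 - 1 / 2 ^ Suc (length r)) / 2 ^ n"
      using grid_name_error order_trans by blast
    then show ?thesis using False by auto
  qed
qed

text \<open>
  Consecutive glued names agree below \<open>N l\<close>, so the machine gives the same approximation number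
  \<open>l + 1\<close> for both, and each of the two values is within \<open>2\<^sup>-\<^sup>(\<^sup>l\<^sup>+\<^sup>1\<^sup>)\<close> of it.
\<close>

lemma game_formula_if_computable:
  fixes f :: "((real ^ ('n::{finite,linorder})) \<times> real) set"
  assumes "relatively_computable f"
  shows "\<exists>\<delta> :: nat \<Rightarrow> real. (\<forall>l\<ge>1. \<delta> l > 0) \<and> game_formula f \<delta>"
proof -
  obtain \<O> M where M: "\<forall>q. \<forall>x\<in>unit_cube. is_name q x \<longrightarrow>
      (\<exists>p. computes_output M \<O> (code_seq code_vec q) (code_seq code_rat p) \<and>
        (\<exists>y \<in> f `` {x}. \<forall>m. \<bar>y - of_rat (p m)\<bar> \<le> 1 / 2 ^ m))"
    using assms unfolding relatively_computable_def is_name_def by blast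
  then have "\<forall>q x. \<exists>p y. x \<in> unit_cube \<longrightarrow> is_name q x \<longrightarrow>
      computes_output M \<O> (code_seq code_vec q) (code_seq code_rat p) \<and>
      y \<in> f `` {x} \<and> (\<forall>m. \<bar>y - of_rat (p m)\<bar> \<le> 1 / 2 ^ m)"
    by blast
  then obtain P Y where PY: "\<And>q x. x \<in> unit_cube \<Longrightarrow> is_name q x \<Longrightarrow>
      computes_output M \<O> (code_seq code_vec q) (code_seq code_rat (P q x)) \<and>
      Y q x \<in> f `` {x} \<and> (\<forall>m. \<bar>Y q x - of_rat (P q x m)\<bar> \<le> 1 / 2 ^ m)"
    by metis
  \<comment> \<open>\<open>N l\<close> entries fix approximation \<open>l + 1\<close>, which has half the error that round \<open>l\<close> allows.\<close>
  let ?G = "\<lambda>i. (\<lambda>x. grid_name x i) ` (unit_cube :: (real, 'n) vec set)"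
  have "\<forall>l. \<exists>N. \<forall>q x q' p p'. x \<in> unit_cube \<longrightarrow> is_name q x \<longrightarrow> (\<forall>i. q i \<in> ?G i) \<longrightarrow>
      (\<forall>i<N. q' i = q i) \<longrightarrow>
      computes_output M \<O> (code_seq code_vec q) (code_seq code_rat p) \<longrightarrow>
      computes_output M \<O> (code_seq code_vec q') (code_seq code_rat p') \<longrightarrow> p' (Suc l) = p (Suc l)"
    using PY by (intro allI uniform_output_modulus finite_grid) blast
  then obtain N where N: "\<And>l q x q' p p'. x \<in> unit_cube \<Longrightarrow> is_name q x \<Longrightarrow>
      (\<forall>i. q i \<in> ?G i) \<Longrightarrow> (\<forall>i<N l. q' i = q i) \<Longrightarrow>
      computes_output M \<O> (code_seq code_vec q) (code_seq code_rat p) \<Longrightarrow>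
      computes_output M \<O> (code_seq code_vec q') (code_seq code_rat p') \<Longrightarrow> p' (Suc l) = p (Suc l)"
    by metis
  define \<delta> :: "nat \<Rightarrow> real" where "\<delta> l = 1 / 2 ^ (N l + l + 1)" for l
  define \<eta> where "\<eta> xs = Y (glued_name \<delta> N (rev xs)) (last xs)" for xs
  have "game_formula f \<delta>"
    unfolding game_formula_def Let_def
  proof (intro exI[of _ \<eta>] allI impI)
    fix x :: "nat \<Rightarrow> (real, 'n) vec" assume x: "\<forall>l\<ge>1. x l \<in> unit_cube"
    define r where "r l = rev (map x [1..<l + 1])" for l
    have r: "r l \<noteq> []" "hd (r l) = x l" "length (r l) = l" "set (r l) \<subseteq> unit_cube"
      "r (Suc l) = x (Suc l) # r l" if "1 \<le> l" for l
      using that x by (auto simp: r_def hd_rev last_map)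
    define q where "q l = glued_name \<delta> N (r l)" for l
    have \<eta>: "\<eta> (map x [1..<l + 1]) = Y (q l) (x l)" if "1 \<le> l" for l
      using that by (simp add: \<eta>_def q_def r_def)
    have grid: "\<forall>i. q l i \<in> ?G i" if "1 \<le> l" for l
      unfolding q_def using r[OF that] glued_name_in_grid by blast
    have name: "is_name (q l) (x l)" if "1 \<le> l" for l
      unfolding is_name_def
    proof
      fix n
      have "infnorm (x l - real_vec (q l n)) \<le> (1 - 1 / 2 ^ l) / 2 ^ n"
        using glued_name_error[of \<delta> N "r l" n] r[OF that] by (simp add: \<delta>_def q_def)
      also have "\<dots> \<le> 1 / 2 ^ n" by (intro divide_right_mono) auto
      finally show "infnorm (x l - real_vec (q l n)) \<le> 1 / 2 ^ n" .
    qed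
    have PYq: "computes_output M \<O> (code_seq code_vec (q l)) (code_seq code_rat (P (q l) (x l)))"
      "Y (q l) (x l) \<in> f `` {x l}"
      "\<bar>Y (q l) (x l) - of_rat (P (q l) (x l) m)\<bar> \<le> 1 / 2 ^ m" if "1 \<le> l" for l m
      using PY[OF _ name[OF that]] x that by auto
    have near: "\<bar>Y (q l) (x l) - Y (q (Suc l)) (x (Suc l))\<bar> \<le> 1 / 2 ^ l"
      if l: "1 \<le> l" and close: "infnorm (x (Suc l) - x l) \<le> \<delta> l" for l
    proof -
      have "\<forall>i<N l. q (Suc l) i = q l i"
        using close r[OF l] by (simp add: q_def)
      then have "P (q (Suc l)) (x (Suc l)) (Suc l) = P (q l) (x l) (Suc l)"
        using N[of "x l" "q l"] x l name grid PYq(1) by simp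
      then show ?thesis
        using PYq(3)[of l "Suc l"] PYq(3)[of "Suc l" "Suc l"] l by simp
    qed
    have "\<eta> (map x [1..<1 + 1]) = Y (q 1) (x 1)"
      "\<And>l. \<eta> (map x [1..<l + 1 + 1]) = Y (q (l + 1)) (x (l + 1))"
      by (rule \<eta>, simp)+
    then show "\<eta> (map x [1..<1 + 1]) \<in> f `` {x 1} \<and>
        (\<forall>l\<ge>1. x (l + 1) \<in> max_cball (x l) (\<delta> l) \<longrightarrow>
          \<eta> (map x [1..<l + 1 + 1]) \<in> f `` {x (l + 1)} \<inter> cball (\<eta> (map x [1..<l + 1])) (1 / 2 ^ l))"
      using PYq(2) near \<eta> by (simp add: max_cball_def dist_real_def del: upt_Suc)
  qed
  moreover have "\<forall>l\<ge>1. \<delta> l > 0" by (simp add: \<delta>_def)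
  ultimately show ?thesis by blast
qed

section \<open>The characterization\<close>

lemma compact_graph_maps_compact_to_compact:
  fixes f :: "((real ^ 'n) \<times> real) set"
  assumes "compact f"
  shows "maps_compact_to_compact f"
  unfolding maps_compact_to_compact_def
proof (intro allI impI)
  fix S :: "(real, 'n) vec set" assume "compact S"
  have "f `` S = snd ` (f \<inter> S \<times> UNIV)" by force
  moreover have "compact (f \<inter> S \<times> UNIV)"
    using assms \<open>compact S\<close> by (intro compact_Int_closed closed_Times) (auto intro: compact_imp_closed)
  ultimately show "compact (f `` S)"
    by (simp add: compact_continuous_image continuous_on_snd)
qed

theorem corollary29:
  fixes f :: "((real ^ ('n::{finite,linorder})) \<times> real) set"
  assumes "f \<subseteq> unit_cube \<times> UNIV"
    and "total_on_cube f"
  shows "(maps_compact_to_compact f \<longrightarrow>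
            (relatively_computable f \<longleftrightarrow>
              (\<exists>\<delta> :: nat \<Rightarrow> real. (\<forall>l\<ge>1. \<delta> l > 0) \<and> game_formula f \<delta>))) \<and>
         (compact f \<longrightarrow> maps_compact_to_compact f)"
proof -
  have "closed (f `` {x})" if "maps_compact_to_compact f" "x \<in> unit_cube" for x
    using that unfolding maps_compact_to_compact_def by (auto intro: compact_imp_closed)
  then show ?thesis
    using computable_if_game_formula[of f] game_formula_if_computable[of f]
      compact_graph_maps_compact_to_compact[of f]
    by blast
qed

end
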